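(* For every $\varepsilon>0$ there exist $C_\varepsilon,D_\varepsilon>0$ such that for all $n\in\mathbb{N}$, $$\frac{\#\{f\in\mathbb{F}_2[x]:\deg(f)=n,\ (2-\varepsilon)n\le\tau(f)\le(2+\varepsilon)n\}}{2^n}\ge 1-C_\varepsilon e^{-D_\varepsilon\sqrt{n}}.$$
   Context: Define $T:\mathbb{F}_2[x]\to\mathbb{F}_2[x]$ by $T(f)=\frac{f}{x+1}$ if $f(1)=0$ and $T(f)=\frac{xf+1}{x+1}$ if $f(1)=1$. For nonzero $f$, $\tau(f)$ is the least $k\in\mathbb{N}$ with $T^k(f)=1$ (this is finite). *)

theory Defs
  imports "HOL-Analysis.Analysis" "HOL-Library.Z2" "HOL-Computational_Algebra.Polynomial"
begin

definition T_map :: "bit poly \<Rightarrow> bit poly" where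
  "T_map f = (if poly f 1 = 0 then f div [:1, 1:]
              else ([:0, 1:] * f + 1) div [:1, 1:])"

text \<open>tau f = least k with T^k(f) = 1 (meaningful for nonzero f).\<close>
definition tau :: "bit poly \<Rightarrow> nat" where
  "tau f = (LEAST k. (T_map ^^ k) f = 1)"

end

theory Submission
  imports Defs
begin

text \<open>
  An even step lowers the degree by one and an odd step preserves it, so \<open>tau f\<close> exceeds the degree
  by the number of odd steps. The first \<open>m\<close> parities determine a polynomial of degree \<open>m\<close>, hence by
  Chernoff's bound all but a proportion \<open>2 exp (-\<delta>\<^sup>2 m)\<close> of these polynomials are balanced: their
  first \<open>m\<close> steps are about half odd and lead to degree about \<open>m / 2\<close>. To iterate this along the
  orbit of a random \<open>f\<close> of degree \<open>n\<close>, observe that for a fixed time \<open>t\<close> the value of the \<open>t\<close>-th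
  iterate determines the leading \<open>m + 1\<close> coefficients of \<open>f\<close>, where \<open>m\<close> is the degree of that iterate;
  so each value has at most \<open>2 ^ (n - m)\<close> preimages. A union bound over \<open>t\<close> and over \<open>m\<close> of order at
  least \<open>sqrt n\<close> shows that typically all iterates of such degrees are balanced, and then summing
  \<open>m + m / 2 + m / 4 + \<dots>\<close> gives \<open>tau f\<close> close to \<open>2 n\<close>. Below degree of order \<open>sqrt n\<close> the
  deterministic quadratic bound on \<open>tau\<close> suffices; this is the origin of the exponent \<open>sqrt n\<close>.
\<close>

section \<open>The map \<open>T_map\<close> and degrees\<close>

lemma dvd_iff_poly_1: "[:1, 1:] dvd f \<longleftrightarrow> poly f 1 = 0" for f :: "bit poly"
  using poly_eq_0_iff_dvd[of f 1] by simp

lemma T_map_even: "poly f 1 = 0 \<Longrightarrow> [:1, 1:] * T_map f = f"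
  by (simp add: T_map_def dvd_iff_poly_1[symmetric] del: mult_pCons_left)

lemma T_map_odd:
  assumes "poly f 1 \<noteq> 0" shows "[:1, 1:] * T_map f = [:0, 1:] * f + 1"
proof -
  have "[:1, 1:] dvd [:0, 1:] * f + 1" unfolding dvd_iff_poly_1 using assms by simp
  then show ?thesis using assms by (simp add: T_map_def del: mult_pCons_left)
qed

lemma T_map_1 [simp]: "T_map 1 = 1"
proof -
  have "[:1, 1:] * T_map 1 = [:1, 1:] * 1" by (subst T_map_odd) (simp_all add: one_pCons)
  then show ?thesis by (simp del: mult_pCons_left)
qed

lemma T_map_funpow_1 [simp]: "(T_map ^^ k) 1 = 1"
  by (induction k) simp_all

lemma T_map_nonzero:
  assumes "f \<noteq> 0" shows "T_map f \<noteq> 0"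
proof
  assume "T_map f = 0"
  then have "f = 0 \<or> [:0, 1:] * f + 1 = 0" using T_map_even[of f] T_map_odd[of f] by force
  moreover have "poly ([:0, 1:] * f + 1) 0 \<noteq> 0" by simp
  ultimately show False using assms by (metis poly_0)
qed

lemma degree_T_map:
  assumes "f \<noteq> 0"
  shows "Suc (degree (T_map f)) = degree f + (if poly f 1 = 0 then 0 else 1)"
proof -
  have *: "degree ([:1, 1:] * T_map f) = Suc (degree (T_map f))"
    using T_map_nonzero[OF assms] by (subst degree_mult_eq) auto
  show ?thesis
  proof (cases "poly f 1 = 0")
    case True
    then show ?thesis using * T_map_even by simp
  next
    case False
    have "degree ([:0, 1:] * f + 1) = degree ([:0, 1:] * f)"
      by (rule degree_add_eq_left) (use assms in simp)
    then show ?thesis using * False assms T_map_odd by simp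
  qed
qed

lemma T_map_funpow_nonzero: "f \<noteq> 0 \<Longrightarrow> (T_map ^^ k) f \<noteq> 0"
  by (induction k) (simp_all add: T_map_nonzero)

section \<open>Parity vectors\<close>

text \<open>The parity vector of the first \<open>k\<close> steps, encoded as a subset of
  \<open>{..<k}\<close> so that its cardinality counts odd steps.\<close>

definition odd_times :: "nat \<Rightarrow> bit poly \<Rightarrow> nat set" where
  "odd_times k f = {i. i < k \<and> poly ((T_map ^^ i) f) 1 \<noteq> 0}"

lemma odd_times_0 [simp]: "odd_times 0 f = {}"
  by (simp add: odd_times_def)

lemma odd_times_subset: "odd_times k f \<subseteq> {..<k}"
  by (auto simp: odd_times_def)

lemma card_odd_times_Suc:
  "card (odd_times (Suc k) f) = card (odd_times k f) + (if poly ((T_map ^^ k) f) 1 = 0 then 0 else 1)"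
proof -
  have "odd_times (Suc k) f = (if poly ((T_map ^^ k) f) 1 = 0 then {} else {k}) \<union> odd_times k f"
    by (auto simp: odd_times_def less_Suc_eq)
  moreover have "finite (odd_times k f)" "k \<notin> odd_times k f"
    by (auto simp: odd_times_def)
  ultimately show ?thesis by simp
qed

lemma degree_T_map_funpow:
  assumes "f \<noteq> 0"
  shows "degree ((T_map ^^ k) f) + k = degree f + card (odd_times k f)"
proof (induction k)
  case (Suc k)
  then show ?case
    using degree_T_map[OF T_map_funpow_nonzero[OF assms, of k]] by (simp add: card_odd_times_Suc)
qed simp

text \<open>Equal parities mean that both orbits undergo the same affine maps, whose constants
  cancel in the difference; the exponent \<open>j\<close> counts the common odd steps.\<close>

lemma odd_times_eq_imp_diff:
  assumes "odd_times k f = odd_times k g"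
  shows "\<exists>j. [:1, 1:] ^ k * ((T_map ^^ k) f - (T_map ^^ k) g) = [:0, 1:] ^ j * (f - g)"
  using assms
proof (induction k)
  case 0
  then show ?case by (auto intro: exI[of _ 0])
next
  case (Suc k)
  define F G where "F = (T_map ^^ k) f" and "G = (T_map ^^ k) g"
  have "odd_times k f = odd_times (Suc k) f \<inter> {..<k}" "odd_times k g = odd_times (Suc k) g \<inter> {..<k}"
    by (auto simp: odd_times_def)
  with Suc obtain j where j: "[:1, 1:] ^ k * (F - G) = [:0, 1:] ^ j * (f - g)"
    unfolding F_def G_def by metis
  have "k \<in> odd_times (Suc k) f \<longleftrightarrow> k \<in> odd_times (Suc k) g" using Suc.prems by simp
  then have par: "poly F 1 = 0 \<longleftrightarrow> poly G 1 = 0" 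
    by (simp add: odd_times_def F_def G_def del: bit_not_zero_iff)
  have eq: "[:1, 1:] ^ Suc k * (T_map F - T_map G) = [:1, 1:] ^ k * ([:1, 1:] * T_map F - [:1, 1:] * T_map G)"
    by (simp only: power_Suc algebra_simps)
  show ?case
  proof (cases "poly F 1 = 0")
    case True
    then have "[:1, 1:] ^ Suc k * (T_map F - T_map G) = [:0, 1:] ^ j * (f - g)"
      using par j unfolding eq by (simp only: T_map_even)
    then show ?thesis by (auto simp: F_def G_def simp del: mult_pCons_left)
  next
    case False
    then have "[:1, 1:] * T_map F - [:1, 1:] * T_map G = [:0, 1:] * (F - G)"
      using par T_map_odd[of F] T_map_odd[of G] by (simp only: right_diff_distrib) simp
    then have "[:1, 1:] ^ Suc k * (T_map F - T_map G) = [:0, 1:] * ([:1, 1:] ^ k * (F - G))"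
      unfolding eq by (simp only: ac_simps)
    also have "\<dots> = [:0, 1:] ^ Suc j * (f - g)"
      unfolding j by (simp only: power_Suc ac_simps)
    finally show ?thesis unfolding F_def G_def by (auto simp del: mult_pCons_left power_Suc)
  qed
qed

text \<open>The factor x has order 0 at the root 1, so all \<open>k\<close> factors x + 1 must come
  from \<open>f - g\<close>.\<close>

lemma odd_times_eq_imp_dvd:
  assumes "odd_times k f = odd_times k g"
  shows "[:1, 1:] ^ k dvd f - g"
proof (cases "f = g")
  case False
  obtain j where j: "[:1, 1:] ^ k * ((T_map ^^ k) f - (T_map ^^ k) g) = [:0, 1:] ^ j * (f - g)"
    using odd_times_eq_imp_diff[OF assms] by blast
  have nz: "[:0, 1:] ^ j * (f - g) \<noteq> 0" using False by simp
  \<comment> \<open>In \<open>bit\<close>, \<open>- 1 = 1\<close>, so this is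
    \<open>[:1, 1:] ^ k\<close> in the form that \<open>order\<close> at 1 expects.\<close>
  have "[:- 1, 1:] ^ k dvd [:0, 1:] ^ j * (f - g)" unfolding j[symmetric] by simp
  then have "k \<le> order 1 ([:0, 1:] ^ j * (f - g))" using nz order_divides by blast
  also have "\<dots> = order 1 ([:0, 1:] ^ j :: bit poly) + order 1 (f - g)" using nz by (rule order_mult)
  also have "order 1 ([:0, 1:] ^ j :: bit poly) = 0" by (rule order_0I) simp
  finally have "[:- 1, 1:] ^ k dvd f - g" using order_divides[of 1 k "f - g"] by auto
  then show ?thesis by simp
qed simp

lemma odd_times_eq_imp_eq:
  assumes "odd_times k f = odd_times k g" "degree (f - g) < k"
  shows "f = g"
proof (rule ccontr)
  assume "f \<noteq> g"
  then have "degree ([:1, 1 :: bit:] ^ k) \<le> degree (f - g)"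
    using odd_times_eq_imp_dvd[OF assms(1)] by (intro dvd_imp_degree_le) auto
  then show False using assms(2) by (simp add: degree_power_eq)
qed

lemma lead_coeff_bit: "f \<noteq> 0 \<Longrightarrow> lead_coeff f = 1" for f :: "bit poly"
  by (cases "lead_coeff f") auto

text \<open>Over F_2 both leading coefficients are 1 and cancel.\<close>

lemma degree_diff_less_bit:
  fixes f g :: "bit poly"
  assumes "f \<noteq> g" "f \<noteq> 0" "g \<noteq> 0" "degree f = degree g"
  shows "degree (f - g) < degree f"
proof -
  have "coeff (f - g) (degree f) = 0"
    using lead_coeff_bit[OF assms(2)] lead_coeff_bit[OF assms(3)] assms(4) by simp
  moreover have "degree (f - g) \<le> degree f" using assms(4) by (intro degree_diff_le) auto
  ultimately show ?thesis using assms(1) by (metis eq_iff_diff_eq_0 le_neq_implies_less leading_coeff_0_iff)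
qed

text \<open>A nonzero difference has degree below \<open>n\<close>, too small for a multiple of (x +
  1)^n. This lets sums over polynomials be bounded by sums over subsets of
  \<open>{..<n}\<close>.\<close>

lemma inj_on_odd_times: "inj_on (odd_times n) {f. f \<noteq> 0 \<and> degree f = n}"
  by (rule inj_onI) (metis (mono_tags, lifting) degree_diff_less_bit mem_Collect_eq odd_times_eq_imp_eq)

section \<open>Termination and the stopping time\<close>

lemma degree_0_bit: "f \<noteq> 0 \<Longrightarrow> degree f = 0 \<Longrightarrow> f = 1" for f :: "bit poly"
  using degree_diff_less_bit[of f 1] by auto

text \<open>A run of odd steps from \<open>f\<close> has the same parities as the orbit of the fixed point \<open>1\<close>,
  so it cannot be longer than \<open>degree f\<close>.\<close>
lemma T_map_degree_drop:
  assumes "f \<noteq> 0" "degree f > 0"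
  shows "\<exists>k \<le> Suc (degree f). degree ((T_map ^^ k) f) < degree f"
proof -
  let ?k = "Suc (degree f)"
  have ne: "f \<noteq> 1" using assms(2) by auto
  have "degree (f - 1) < ?k" by (metis degree_1 degree_diff_le le0 less_Suc_eq_le order_refl)
  then have "odd_times ?k f \<noteq> odd_times ?k 1" using odd_times_eq_imp_eq ne by blast
  moreover have "odd_times ?k 1 = {..<?k}" by (auto simp: odd_times_def)
  ultimately have "odd_times ?k f \<subset> {..<?k}" using odd_times_subset by auto
  then have "card (odd_times ?k f) < ?k" by (metis card_lessThan finite_lessThan psubset_card_mono)
  then show ?thesis using degree_T_map_funpow[OF assms(1), of ?k] by (intro exI[of _ ?k]) simp
qed

text \<open>At most d + 1 steps lower a positive degree d, and by induction at most d^2 more reach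
  1; the total is at most (d + 1)^2.\<close>

lemma T_map_reaches_1:
  assumes "f \<noteq> 0"
  shows "\<exists>k \<le> (Suc (degree f))\<^sup>2. (T_map ^^ k) f = 1"
  using assms
proof (induction "degree f" arbitrary: f rule: less_induct)
  case less
  show ?case
  proof (cases "degree f = 0")
    case True
    then show ?thesis using degree_0_bit[OF less.prems] by auto
  next
    case False
    then obtain j where j: "j \<le> Suc (degree f)" "degree ((T_map ^^ j) f) < degree f"
      using T_map_degree_drop less.prems by blast
    then obtain k where k: "k \<le> (Suc (degree ((T_map ^^ j) f)))\<^sup>2" "(T_map ^^ k) ((T_map ^^ j) f) = 1"
      using less.hyps T_map_funpow_nonzero less.prems by metis
    have "(Suc (degree ((T_map ^^ j) f)))\<^sup>2 \<le> (degree f)\<^sup>2" using j(2) by (intro power_mono) auto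
    then have "k + j \<le> (Suc (degree f))\<^sup>2" using j(1) k(1) by (simp add: power2_eq_square)
    then show ?thesis using k(2) by (auto simp: funpow_add intro!: exI[of _ "k + j"])
  qed
qed

lemma T_map_funpow_tau: "f \<noteq> 0 \<Longrightarrow> (T_map ^^ tau f) f = 1"
  unfolding tau_def using T_map_reaches_1 by (metis (mono_tags, lifting) LeastI)

lemma tau_le: "(T_map ^^ k) f = 1 \<Longrightarrow> tau f \<le> k"
  unfolding tau_def by (rule Least_le)

lemma tau_le_square: "f \<noteq> 0 \<Longrightarrow> tau f \<le> (Suc (degree f))\<^sup>2"
  using T_map_reaches_1 tau_le by (meson order_trans)

lemma tau_1 [simp]: "tau 1 = 0"
  using tau_le[of 0 1] by simp

lemma degree_le_tau: "f \<noteq> 0 \<Longrightarrow> degree f \<le> tau f"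
  using degree_T_map_funpow[of f "tau f"] T_map_funpow_tau[of f] by simp

text \<open>Since 1 is a fixed point, an orbit that has reached it stays there.\<close>

lemma less_tau:
  assumes "f \<noteq> 0" "(T_map ^^ k) f \<noteq> 1"
  shows "k < tau f"
proof (rule ccontr)
  assume "\<not> k < tau f"
  then have "(T_map ^^ k) f = (T_map ^^ (k - tau f)) ((T_map ^^ tau f) f)"
    by (metis comp_apply funpow_add le_add_diff_inverse2 not_less)
  then show False using assms T_map_funpow_tau by simp
qed

lemma tau_funpow:
  assumes "f \<noteq> 0" "k \<le> tau f"
  shows "tau f = k + tau ((T_map ^^ k) f)"
proof (rule antisym)
  have "(T_map ^^ (tau ((T_map ^^ k) f) + k)) f = 1"
    using T_map_funpow_tau[OF T_map_funpow_nonzero[OF assms(1)]] by (simp add: funpow_add)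
  then show "tau f \<le> k + tau ((T_map ^^ k) f)" using tau_le by (simp add: add.commute)
  have "(T_map ^^ (tau f - k)) ((T_map ^^ k) f) = 1"
    using T_map_funpow_tau[OF assms(1)] assms(2) by (metis comp_apply funpow_add le_add_diff_inverse2)
  then have "tau ((T_map ^^ k) f) \<le> tau f - k" by (rule tau_le)
  then show "k + tau ((T_map ^^ k) f) \<le> tau f" using assms(2) by simp
qed

section \<open>Fibres of the iterates\<close>

text \<open>Clears denominators. An odd step multiplies the correction \<open>p\<close> by x and
  adds (x + 1)^k, so its degree stays below the number of steps. The alternative
  \<open>p = 0\<close> covers \<open>k = 0\<close>, where no degree is small enough.\<close>

lemma T_map_funpow_expansion:
  "\<exists>p. [:1, 1:] ^ k * (T_map ^^ k) f = [:0, 1:] ^ card (odd_times k f) * f + p \<and>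
       (p = 0 \<or> degree p < k)"
proof (induction k)
  case (Suc k)
  define F where "F = (T_map ^^ k) f"
  define j where "j = card (odd_times k f)"
  obtain p where p: "[:1, 1:] ^ k * F = [:0, 1:] ^ j * f + p" "p = 0 \<or> degree p < k"
    using Suc unfolding F_def j_def by blast
  have eq: "[:1, 1:] ^ Suc k * T_map F = [:1, 1:] ^ k * ([:1, 1:] * T_map F)"
    by (simp only: power_Suc ac_simps)
  show ?case
  proof (cases "poly F 1 = 0")
    case True
    then have "[:1, 1:] ^ Suc k * T_map F = [:0, 1:] ^ j * f + p"
      unfolding eq by (simp only: T_map_even p)
    then show ?thesis using True p(2)
      by (intro exI[of _ p]) (auto simp add: card_odd_times_Suc F_def j_def simp del: mult_pCons_left power_Suc)
  next
    case False
    have "[:1, 1:] ^ Suc k * T_map F = [:0, 1:] * ([:1, 1:] ^ k * F) + [:1, 1:] ^ k"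
      unfolding eq T_map_odd[OF False] by (simp only: algebra_simps mult_1)
    also have "\<dots> = [:0, 1:] ^ Suc j * f + ([:0, 1:] * p + [:1, 1:] ^ k)"
      unfolding p(1) by (simp only: power_Suc algebra_simps)
    finally have *: "[:1, 1:] ^ Suc k * T_map F = [:0, 1:] ^ Suc j * f + ([:0, 1:] * p + [:1, 1:] ^ k)" .
    have "degree ([:0, 1:] * p) \<le> k" using p(2) by (cases "p = 0") auto
    then have "degree ([:0, 1:] * p + [:1, 1:] ^ k) \<le> k"
      by (intro degree_add_le) (simp_all add: degree_power_eq)
    then show ?thesis using False *
      by (intro exI[of _ "[:0, 1:] * p + [:1, 1:] ^ k"])
         (auto simp add: card_odd_times_Suc F_def j_def simp del: mult_pCons_left power_Suc)
  qed
qed simp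

text \<open>Equal degrees at both ends force the same number of odd steps, so subtracting the two
  expansions leaves only corrections of degree below \<open>k\<close>. Thus \<open>f\<close> and
  \<open>g\<close> agree in their top \<open>degree ((T_map ^^ k) f) + 1\<close>
  coefficients.\<close>

lemma degree_diff_T_map_fiber:
  assumes "f \<noteq> 0" "g \<noteq> 0" "degree f = degree g" "(T_map ^^ k) f = (T_map ^^ k) g" "f \<noteq> g"
  shows "degree (f - g) + degree ((T_map ^^ k) f) < degree f"
proof -
  define j where "j = card (odd_times k f)"
  have deg: "degree ((T_map ^^ k) f) + k = degree f + j"
    using degree_T_map_funpow[OF assms(1)] by (simp add: j_def)
  have j': "card (odd_times k g) = j"
    using degree_T_map_funpow[OF assms(1), of k] degree_T_map_funpow[OF assms(2), of k] assms
    by (simp add: j_def)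
  obtain p where p: "[:1, 1:] ^ k * (T_map ^^ k) f = [:0, 1:] ^ j * f + p" "p = 0 \<or> degree p < k"
    using T_map_funpow_expansion[of k f] unfolding j_def by blast
  obtain r where r: "[:1, 1:] ^ k * (T_map ^^ k) g = [:0, 1:] ^ j * g + r" "r = 0 \<or> degree r < k"
    using T_map_funpow_expansion[of k g] unfolding j' by blast
  have eq: "[:0, 1:] ^ j * (f - g) = r - p"
    using p(1) r(1) assms(4) by (simp add: algebra_simps)
  have "r - p \<noteq> 0" using assms(5) unfolding eq[symmetric] by simp
  then have "degree (r - p) < k" using p(2) r(2)
    by (metis degree_diff_less degree_minus diff_0 diff_zero)
  moreover have "degree (r - p) = j + degree (f - g)"
    unfolding eq[symmetric] using assms(5) by (subst degree_mult_eq) (auto simp: degree_power_eq)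
  ultimately show ?thesis using deg by simp
qed


section \<open>Counting polynomials over F_2\<close>

lemma UNIV_bit: "(UNIV :: bit set) = {0, 1}"
  by (auto intro: bit.exhaust)

text \<open>Doubling step of both counts below: the constant coefficient is free.\<close>

lemma card_pCons_image:
  assumes "finite A"
  shows "finite ((\<lambda>(a :: bit, p). pCons a p) ` (UNIV \<times> A))"
    and "card ((\<lambda>(a :: bit, p). pCons a p) ` (UNIV \<times> A)) = 2 * card A"
proof -
  show "finite ((\<lambda>(a :: bit, p). pCons a p) ` (UNIV \<times> A))" using assms by (simp add: UNIV_bit)
  have "inj_on (\<lambda>(a :: bit, p). pCons a p) (UNIV \<times> A)" by (auto simp: inj_on_def)
  then show "card ((\<lambda>(a :: bit, p). pCons a p) ` (UNIV \<times> A)) = 2 * card A"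
    by (simp add: card_image card_cartesian_product UNIV_bit)
qed

lemma degree_eq_bit_polys:
  "finite {f :: bit poly. f \<noteq> 0 \<and> degree f = n} \<and> card {f :: bit poly. f \<noteq> 0 \<and> degree f = n} = 2 ^ n"
proof (induction n)
  case 0
  have "{f :: bit poly. f \<noteq> 0 \<and> degree f = 0} = {1}" using degree_0_bit by auto
  then show ?case by simp
next
  case (Suc n)
  have "{f :: bit poly. f \<noteq> 0 \<and> degree f = Suc n} =
        (\<lambda>(a, p). pCons a p) ` (UNIV \<times> {f. f \<noteq> 0 \<and> degree f = n})" (is "?L = ?R")
  proof
    show "?L \<subseteq> ?R"
    proof
      fix f assume f: "f \<in> ?L"
      obtain a p where "f = pCons a p" by (cases f) auto
      then show "f \<in> ?R" using f by (auto split: if_splits)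
    qed
  qed (auto split: if_splits)
  then show ?case using card_pCons_image Suc by simp
qed

lemma degree_less_bit_polys:
  "finite {f :: bit poly. f = 0 \<or> degree f < n} \<and> card {f :: bit poly. f = 0 \<or> degree f < n} = 2 ^ n"
proof (induction n)
  case (Suc n)
  have "{f :: bit poly. f = 0 \<or> degree f < Suc n} =
        (\<lambda>(a, p). pCons a p) ` (UNIV \<times> {f. f = 0 \<or> degree f < n})" (is "?L = ?R")
  proof
    show "?L \<subseteq> ?R"
    proof
      fix f assume f: "f \<in> ?L"
      obtain a p where "f = pCons a p" by (cases f) auto
      then show "f \<in> ?R" using f by (auto split: if_splits)
    qed
  qed (auto split: if_splits)
  then show ?case using card_pCons_image Suc by simp
qed simp

text \<open>Subtracting one fixed member embeds the fibre into 0 and the polynomials of degree below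
  \<open>n - degree g\<close>.\<close>

lemma card_T_map_fiber:
  "card {f. f \<noteq> 0 \<and> degree f = n \<and> (T_map ^^ k) f = g} \<le> 2 ^ (n - degree g)" (is "card ?A \<le> _")
proof (cases "?A = {}")
  case False
  then obtain f0 where f0: "f0 \<in> ?A" by blast
  let ?D = "{f :: bit poly. f = 0 \<or> degree f < n - degree g}"
  have "(\<lambda>f. f - f0) ` ?A \<subseteq> ?D"
  proof
    fix h assume "h \<in> (\<lambda>f. f - f0) ` ?A"
    then obtain f where f: "f \<in> ?A" "h = f - f0" by blast
    then show "h \<in> ?D" using degree_diff_T_map_fiber[of f f0 k] f0 by fastforce
  qed
  then have "card ?A \<le> card ?D"
    using degree_less_bit_polys by (intro card_inj_on_le) (auto simp: inj_on_def)
  then show ?thesis using degree_less_bit_polys by simp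
qed (simp only: card.empty)

section \<open>Concentration of parities along orbits\<close>

text \<open>Moment generating function of a sum of \<open>m\<close> fair signs, scaled by 2^m: an
  index inside \<open>S\<close> contributes \<open>exp l\<close>, one outside
  \<open>exp (- l)\<close>.\<close>

lemma sum_Pow_exp:
  fixes l :: real
  shows "(\<Sum>S \<in> Pow {..<m}. exp (l * (2 * real (card S) - real m))) = (exp l + exp (- l)) ^ m"
proof -
  have "(exp l + exp (- l)) ^ m = (\<Prod>i<m. exp l + exp (- l))" by simp
  also have "\<dots> = (\<Sum>S \<in> Pow {..<m}. (\<Prod>i\<in>S. exp l) * (\<Prod>i\<in>{..<m} - S. exp (- l)))"
    by (rule prod_add) simp
  also have "\<dots> = (\<Sum>S \<in> Pow {..<m}. exp (l * (2 * real (card S) - real m)))"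
  proof (rule sum.cong)
    fix S assume "S \<in> Pow {..<m}"
    then have S: "S \<subseteq> {..<m}" "finite S" by (auto intro: finite_subset)
    have "card S \<le> m" using S card_mono[of "{..<m}" S] by simp
    moreover have "card ({..<m} - S) = m - card S" using S by (simp add: card_Diff_subset)
    ultimately show "(\<Prod>i\<in>S. exp l) * (\<Prod>i\<in>{..<m} - S. exp (- l)) =
        exp (l * (2 * real (card S) - real m))"
      by (simp add: exp_of_nat_mult[symmetric] mult_exp_exp of_nat_diff algebra_simps)
  qed simp
  finally show ?thesis by simp
qed

lemma exp_plus_exp_minus_le:
  fixes l :: real
  assumes "0 \<le> l" "l \<le> 1"
  shows "exp l + exp (- l) \<le> 2 * exp (l\<^sup>2)"
proof -
  \<comment> \<open>The product equals 1 + l^3.\<close>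
  have "1 \<le> (1 - l + l\<^sup>2) * (1 + l)"
    using assms(1) by (simp add: power2_eq_square algebra_simps)
  also have "\<dots> \<le> (1 - l + l\<^sup>2) * exp l"
    using assms by (intro mult_left_mono exp_ge_add_one_self) auto
  finally have "exp (- l) \<le> 1 - l + l\<^sup>2" by (simp add: exp_minus field_simps)
  moreover have "exp l \<le> 1 + l + l\<^sup>2" using assms by (rule exp_bound)
  moreover have "1 + l\<^sup>2 \<le> exp (l\<^sup>2)" by (rule exp_ge_add_one_self)
  ultimately show ?thesis by linarith
qed

text \<open>The number of steps inspected equals the degree: this is the length at which
  \<open>inj_on_odd_times\<close> applies, and after these steps the degree is exactly the number of
  odd ones.\<close>

definition unbalanced :: "real \<Rightarrow> nat \<Rightarrow> bit poly set" where
  "unbalanced \<delta> m = {g. g \<noteq> 0 \<and> degree g = m \<and>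
     \<bar>real (card (odd_times m g)) - real m / 2\<bar> > \<delta> * real m}"

lemma finite_unbalanced: "finite (unbalanced \<delta> m)"
  by (rule finite_subset[OF _ conjunct1[OF degree_eq_bit_polys[of m]]]) (auto simp: unbalanced_def)

text \<open>Exponential Markov inequality with parameter \<delta>, both tails at once. Injectivity
  moves the sum to all subsets, where it is at most 2 (2 exp(\<delta>^2))^m; dividing by exp(2
  \<delta>^2 m) gives the bound.\<close>

lemma card_unbalanced_le:
  assumes "0 \<le> \<delta>" "\<delta> \<le> 1"
  shows "real (card (unbalanced \<delta> m)) \<le> 2 * 2 ^ m * exp (- (\<delta>\<^sup>2 * real m))"
proof -
  let ?w = "\<lambda>S. \<delta> * (2 * real (card S) - real m)"
  let ?B = "unbalanced \<delta> m"
  have inj: "inj_on (odd_times m) ?B"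
    by (rule inj_on_subset[OF inj_on_odd_times[of m]]) (auto simp: unbalanced_def)
  have "real (card ?B) * exp (2 * \<delta>\<^sup>2 * real m) = (\<Sum>g\<in>?B. exp (2 * \<delta>\<^sup>2 * real m))" by simp
  also have "\<dots> \<le> (\<Sum>g\<in>?B. exp (?w (odd_times m g)) + exp (- ?w (odd_times m g)))"
  proof (rule sum_mono)
    fix g assume "g \<in> ?B"
    then have "2 * \<delta> * real m \<le> \<bar>2 * real (card (odd_times m g)) - real m\<bar>"
      by (auto simp: unbalanced_def)
    then have "\<delta> * (2 * \<delta> * real m) \<le> \<delta> * \<bar>2 * real (card (odd_times m g)) - real m\<bar>"
      using assms(1) by (rule mult_left_mono)
    also have "\<dots> = \<bar>?w (odd_times m g)\<bar>" using assms(1) by (simp add: abs_mult)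
    finally have "exp (2 * \<delta>\<^sup>2 * real m) \<le> exp \<bar>?w (odd_times m g)\<bar>"
      by (simp add: power2_eq_square mult_ac)
    also have "\<dots> \<le> exp (?w (odd_times m g)) + exp (- ?w (odd_times m g))"
      by (cases "?w (odd_times m g) \<ge> 0") auto
    finally show "exp (2 * \<delta>\<^sup>2 * real m) \<le> exp (?w (odd_times m g)) + exp (- ?w (odd_times m g))" .
  qed
  also have "\<dots> = (\<Sum>S \<in> odd_times m ` ?B. exp (?w S) + exp (- ?w S))"
    using inj by (simp add: sum.reindex)
  also have "\<dots> \<le> (\<Sum>S \<in> Pow {..<m}. exp (?w S) + exp (- ?w S))"
    using odd_times_subset by (intro sum_mono2) (auto intro: add_nonneg_nonneg)
  also have "\<dots> = 2 * (exp \<delta> + exp (- \<delta>)) ^ m"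
    using sum_Pow_exp[of \<delta> m] sum_Pow_exp[of "- \<delta>" m]
    by (simp add: sum.distrib add.commute)
  also have "\<dots> \<le> 2 * (2 * exp (\<delta>\<^sup>2)) ^ m"
    using exp_plus_exp_minus_le[OF assms] by (intro mult_left_mono power_mono) auto
  also have "\<dots> = 2 * 2 ^ m * exp (\<delta>\<^sup>2 * real m)"
    by (simp add: power_mult_distrib exp_of_nat2_mult)
  finally have "real (card ?B) * exp (2 * \<delta>\<^sup>2 * real m) * exp (- (2 * \<delta>\<^sup>2 * real m))
      \<le> 2 * 2 ^ m * exp (\<delta>\<^sup>2 * real m) * exp (- (2 * \<delta>\<^sup>2 * real m))"
    by (intro mult_right_mono) auto
  then show ?thesis by (simp add: mult.assoc mult_exp_exp) (simp add: mult.commute)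
qed

text \<open>The time \<open>t\<close> at which an orbit meets an unbalanced polynomial of degree \<open>m\<close> depends on \<open>f\<close>,
  but a union bound over the at most \<open>(n + 1)\<^sup>2\<close> possible times only costs a polynomial factor.\<close>
lemma card_meets_unbalanced_le:
  assumes "0 \<le> \<delta>" "\<delta> \<le> 1"
  shows "real (card {f. f \<noteq> 0 \<and> degree f = n \<and> (\<exists>t m. M \<le> m \<and> (T_map ^^ t) f \<in> unbalanced \<delta> m)})
    \<le> 2 * real (n + 1) ^ 3 * 2 ^ n * exp (- (\<delta>\<^sup>2 * real M))" (is "real (card ?A) \<le> _")
proof -
  let ?F = "\<lambda>t g. {f. f \<noteq> 0 \<and> degree f = n \<and> (T_map ^^ t) f = g}"
  let ?U = "\<Union>t<(n+1)\<^sup>2. \<Union>m\<in>{M..n}. \<Union>g\<in>unbalanced \<delta> m. ?F t g"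
  have "?A \<subseteq> ?U"
  proof
    fix f assume "f \<in> ?A"
    then obtain t m where f: "f \<noteq> 0" "degree f = n" "M \<le> m" "(T_map ^^ t) f \<in> unbalanced \<delta> m" by blast
    have deg: "degree ((T_map ^^ t) f) = m" using f(4) by (simp add: unbalanced_def)
    \<comment> \<open>At \<open>m = 0\<close> both sides of the strict inequality in
      \<open>unbalanced\<close> vanish. Hence the iterate is not 1 and \<open>t\<close> precedes
      \<open>tau f\<close>.\<close>
    have "m \<noteq> 0" using f(4) by (rule contrapos_pn) (simp add: unbalanced_def)
    then have "t < tau f" using deg f(1) by (intro less_tau) auto
    then have "t < (n+1)\<^sup>2" using tau_le_square[OF f(1)] f(2) by simp
    moreover have "card (odd_times t f) \<le> t" using card_mono[OF _ odd_times_subset] by fastforce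
    then have "m \<le> n" using degree_T_map_funpow[OF f(1), of t] deg f(2) by simp
    ultimately show "f \<in> ?U" using f by force
  qed
  moreover have finF: "finite (?F t g)" for t g
    by (rule finite_subset[OF _ conjunct1[OF degree_eq_bit_polys[of n]]]) auto
  then have "finite ?U" by (intro finite_UN_I finite_unbalanced) auto
  ultimately have "card ?A \<le> card ?U" by (intro card_mono)
  also have "\<dots> \<le> (\<Sum>t<(n+1)\<^sup>2. \<Sum>m\<in>{M..n}. \<Sum>g\<in>unbalanced \<delta> m. card (?F t g))"
    by (intro order_trans[OF card_UN_le] sum_mono finite_unbalanced) auto
  also have "\<dots> \<le> (\<Sum>t<(n+1)\<^sup>2. \<Sum>m\<in>{M..n}. \<Sum>g\<in>unbalanced \<delta> m. 2 ^ (n - m))"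
    by (intro sum_mono) (use card_T_map_fiber in \<open>fastforce simp: unbalanced_def\<close>)
  finally have "card ?A \<le> (n+1)\<^sup>2 * (\<Sum>m\<in>{M..n}. card (unbalanced \<delta> m) * 2 ^ (n - m))" by simp
  then have "real (card ?A) \<le> real ((n+1)\<^sup>2 * (\<Sum>m\<in>{M..n}. card (unbalanced \<delta> m) * 2 ^ (n - m)))"
    by (rule of_nat_mono)
  also have "\<dots> = real (n+1) ^ 2 * (\<Sum>m\<in>{M..n}. real (card (unbalanced \<delta> m)) * 2 ^ (n - m))" by simp
  also have "\<dots> \<le> real (n+1) ^ 2 * (\<Sum>m\<in>{M..n}. 2 * 2 ^ n * exp (- (\<delta>\<^sup>2 * real M)))"
  proof (intro mult_left_mono sum_mono)
    fix m assume m: "m \<in> {M..n}"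
    \<comment> \<open>The 2^m from counting unbalanced polynomials and the 2^(n - m) from the fibres
      combine to 2^n for every \<open>m\<close>.\<close>
    have "real (card (unbalanced \<delta> m)) * 2 ^ (n - m) \<le> 2 * 2 ^ m * exp (- (\<delta>\<^sup>2 * real m)) * 2 ^ (n - m)"
      using card_unbalanced_le[OF assms] by (intro mult_right_mono) auto
    also have "\<dots> = 2 * 2 ^ n * exp (- (\<delta>\<^sup>2 * real m))"
      using m by (simp add: power_add[symmetric] mult_ac)
    also have "\<dots> \<le> 2 * 2 ^ n * exp (- (\<delta>\<^sup>2 * real M))"
      using m by (intro mult_left_mono) (auto intro: mult_left_mono)
    finally show "real (card (unbalanced \<delta> m)) * 2 ^ (n - m) \<le> 2 * 2 ^ n * exp (- (\<delta>\<^sup>2 * real M))" .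
  qed simp
  also have "\<dots> \<le> real (n+1) ^ 2 * (real (n+1) * (2 * 2 ^ n * exp (- (\<delta>\<^sup>2 * real M))))"
    by (intro mult_left_mono) (auto intro!: mult_right_mono)
  finally show ?thesis by (simp add: power3_eq_cube power2_eq_square mult_ac)
qed

section \<open>Stopping time of balanced orbits\<close>

text \<open>The induction runs \<open>degree f\<close> steps at a time. Each such block roughly
  halves the degree until it is below \<open>M\<close>, and the error \<open>real M ^ 2\<close> is
  passed on unchanged.\<close>

lemma tau_approx:
  fixes e :: real
  assumes "e > 0" "f \<noteq> 0"
    and "\<And>t m. M \<le> m \<Longrightarrow> (T_map ^^ t) f \<notin> unbalanced (e / (4 + 2 * e)) m"
  shows "\<bar>real (tau f) - 2 * real (degree f)\<bar> \<le> e * real (degree f) + real M ^ 2"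
  using assms(2,3)
proof (induction "degree f" arbitrary: f rule: less_induct)
  case less
  define m where "m = degree f"
  \<comment> \<open>Solves 2 d + e (1/2 + d) = e, so the imbalance of one block plus the inherited
    relative error is again at most e m.\<close>
  define d where "d = e / (4 + 2 * e)"
  have "d * (4 + 2 * e) = e" using assms(1) by (simp add: d_def)
  then have "4 * d + 2 * (e * d) = e" by (simp add: algebra_simps)
  then have d2: "2 * d + e * d = e / 2" by linarith
  have d1: "d < 1 / 2" using assms(1) by (simp add: d_def field_simps)
  \<comment> \<open>Degree 0 is separate because it could not decrease further when
    \<open>M = 0\<close>.\<close>
  consider "m = 0" | "m < M" | "m > 0" "M \<le> m" by linarith
  then show ?case
  proof cases
    case 1
    then have "f = 1" using degree_0_bit less.prems(1) by (simp add: m_def)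
    then show ?thesis by simp
  next
    case 2
    have "tau f \<le> (Suc m)\<^sup>2" using tau_le_square[OF less.prems(1)] by (simp add: m_def)
    then have 1: "real (tau f) \<le> (real m + 1)\<^sup>2" by (metis of_nat_Suc of_nat_le_iff of_nat_power add.commute)
    have 2: "(real m + 1)\<^sup>2 \<le> (real M)\<^sup>2" using 2 by (intro power_mono) auto
    have 3: "2 * real m \<le> (real m + 1)\<^sup>2" by (simp add: power2_eq_square algebra_simps)
    have 4: "e * real m \<ge> 0" using assms(1) by simp
    \<comment> \<open>Both \<open>tau f\<close> and \<open>2 * real m\<close> lie between 0 and
      \<open>real M ^ 2\<close>.\<close>
    show ?thesis using 1 2 3 4 unfolding m_def[symmetric] by linarith
  next
    case 3
    define g where "g = (T_map ^^ m) f"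
    have g0: "g \<noteq> 0" unfolding g_def using less.prems(1) by (rule T_map_funpow_nonzero)
    have deg: "degree g = card (odd_times m f)"
      using degree_T_map_funpow[OF less.prems(1), of m] by (simp add: g_def m_def)
    have "f \<notin> unbalanced d m" using less.prems(2)[of m 0] 3 by (simp add: d_def)
    then have bal: "\<bar>real (degree g) - real m / 2\<bar> \<le> d * real m"
      using less.prems(1) by (simp add: unbalanced_def m_def deg)
    have "d * real m < 1 / 2 * real m" using d1 3 by (intro mult_strict_right_mono) auto
    then have "degree g < degree f" using bal by (simp add: m_def)
    moreover have "(T_map ^^ t) g \<notin> unbalanced (e / (4 + 2 * e)) k" if "M \<le> k" for t k
      using less.prems(2)[OF that, of "t + m"] by (simp add: g_def funpow_add)
    ultimately have IH: "\<bar>real (tau g) - 2 * real (degree g)\<bar> \<le> e * real (degree g) + real M ^ 2"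
      using less.hyps g0 by blast
    have "tau f = m + tau g"
      unfolding g_def using less.prems(1) degree_le_tau by (intro tau_funpow) (auto simp: m_def)
    moreover have "e * real (degree g) \<le> e * (real m / 2 + d * real m)"
      using bal assms(1) by (intro mult_left_mono) auto
    moreover have "2 * (d * real m) + e * (real m / 2 + d * real m) = e * real m"
    proof -
      have "2 * (d * real m) + e * (real m / 2 + d * real m) = (2 * d + e * d + e / 2) * real m"
        by (simp add: algebra_simps)
      then show ?thesis using d2 by simp
    qed
    ultimately show ?thesis using IH bal unfolding m_def[symmetric] by linarith
  qed
qed

section \<open>The proportion of typical polynomials\<close>

text \<open>Absorbs the polynomial factor of the union bound. With s = sqrt n, n + 1 \<le> (1 + s)^2
  turns the cube into a sixth power, and y \<le> exp y is applied to y = a (1 + s) / 6.\<close>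

lemma cube_le_exp_sqrt:
  fixes a :: real
  assumes "a > 0"
  shows "real (n + 1) ^ 3 \<le> (6 / a) ^ 6 * exp a * exp (a * sqrt (real n))"
proof -
  define s where "s = sqrt (real n)"
  have s: "s \<ge> 0" "real n = s\<^sup>2" by (auto simp: s_def)
  have "real (n + 1) \<le> (1 + s)\<^sup>2" using s by (simp add: power2_eq_square algebra_simps)
  then have "real (n + 1) ^ 3 \<le> ((1 + s)\<^sup>2) ^ 3" by (intro power_mono) auto
  also have "\<dots> = (6 / a) ^ 6 * (a / 6 * (1 + s)) ^ 6"
    using assms by (simp add: power_mult_distrib power_divide flip: power_mult)
  also have "\<dots> \<le> (6 / a) ^ 6 * exp (a / 6 * (1 + s)) ^ 6"
  proof (intro mult_left_mono power_mono)
    show "a / 6 * (1 + s) \<le> exp (a / 6 * (1 + s))"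
      using exp_ge_add_one_self[of "a / 6 * (1 + s)"] by linarith
  qed (use assms s in auto)
  also have "exp (a / 6 * (1 + s)) ^ 6 = exp (a * (1 + s))"
    by (simp flip: exp_of_nat_mult)
  also have "\<dots> = exp a * exp (a * s)" by (simp add: distrib_left exp_add)
  finally show ?thesis by (simp add: s_def mult.assoc)
qed

theorem theorem2p15:
  fixes \<epsilon> :: real
  assumes "\<epsilon> > 0"
  shows "\<exists>C D. C > 0 \<and> D > 0 \<and> (\<forall>n::nat.
           real (card {f :: bit poly. f \<noteq> 0 \<and> degree f = n \<and>
                  (2 - \<epsilon>) * real n \<le> real (tau f) \<and> real (tau f) \<le> (2 + \<epsilon>) * real n})
             / 2 ^ n
           \<ge> 1 - C * exp (- D * sqrt (real n)))"
proof -
  \<comment> \<open>One half of \<epsilon> is the relative error in \<open>tau_approx\<close>, the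
    other bounds \<open>real M ^ 2\<close>.\<close>
  define e where "e = \<epsilon> / 2"
  define d where "d = e / (4 + 2 * e)"
  \<comment> \<open>Concentration at degree about sqrt(e n) decays at rate \<open>2 * a\<close> in
    sqrt n; one \<open>a\<close> is spent on the polynomial factor.\<close>
  define a where "a = d\<^sup>2 * sqrt e / 2"
  define C where "C = 2 * ((6 / a) ^ 6 * exp a) * exp (d\<^sup>2)"
  have e: "e > 0" using assms by (simp add: e_def)
  then have d: "0 < d" "d \<le> 1" by (simp_all add: d_def field_simps)
  have a: "a > 0" using d e by (simp add: a_def)
  have "1 - C * exp (- a * sqrt (real n)) \<le> real (card {f :: bit poly. f \<noteq> 0 \<and> degree f = n \<and>
      (2 - \<epsilon>) * real n \<le> real (tau f) \<and> real (tau f) \<le> (2 + \<epsilon>) * real n}) / 2 ^ n"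
    (is "_ \<le> real (card ?G) / _") for n
  proof -
    \<comment> \<open>Largest threshold whose square is at most e n; rounding down costs the factor
      \<open>exp (d\<^sup>2)\<close> in \<open>C\<close>.\<close>
    define M where "M = nat \<lfloor>sqrt (e * real n)\<rfloor>"
    let ?P = "{f :: bit poly. f \<noteq> 0 \<and> degree f = n}"
    let ?A = "{f. f \<noteq> 0 \<and> degree f = n \<and> (\<exists>t m. M \<le> m \<and> (T_map ^^ t) f \<in> unbalanced d m)}"
    have en: "e * real n \<ge> 0" using e by simp
    have M: "real M \<le> sqrt (e * real n)" "sqrt (e * real n) - 1 \<le> real M"
      unfolding M_def using en by (auto simp: of_nat_nat)
    have "real M ^ 2 \<le> sqrt (e * real n) ^ 2" using M(1) by (intro power_mono) auto
    then have M2: "real M ^ 2 \<le> e * real n" using en by simp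
    have "?P \<subseteq> ?G \<union> ?A"
    proof
      fix f assume f: "f \<in> ?P"
      show "f \<in> ?G \<union> ?A"
      proof (cases "f \<in> ?A")
        case False
        then have "\<bar>real (tau f) - 2 * real n\<bar> \<le> e * real n + real M ^ 2"
          using tau_approx[OF e, of f M] f by (auto simp: d_def)
        also have "\<dots> \<le> \<epsilon> * real n" using M2 by (simp add: e_def)
        finally show ?thesis using f by (auto simp: algebra_simps abs_le_iff)
      qed simp
    qed
    moreover have "finite (?G \<union> ?A)"
      by (rule finite_subset[OF _ conjunct1[OF degree_eq_bit_polys[of n]]]) auto
    ultimately have "card ?P \<le> card (?G \<union> ?A)" by (intro card_mono)
    also have "\<dots> \<le> card ?G + card ?A" by (rule card_Un_le)
    finally have "2 ^ n \<le> card ?G + card ?A" using degree_eq_bit_polys by simp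
    then have "real (2 ^ n) \<le> real (card ?G + card ?A)" by (rule of_nat_mono)
    then have le: "2 ^ n \<le> real (card ?G) + real (card ?A)" by simp
    have "exp (- (d\<^sup>2 * real M)) \<le> exp (d\<^sup>2 - 2 * a * sqrt (real n))"
    proof -
      have "d\<^sup>2 * (sqrt (e * real n) - 1) \<le> d\<^sup>2 * real M" using M(2) by (intro mult_left_mono) auto
      then show ?thesis by (simp add: a_def real_sqrt_mult algebra_simps)
    qed
    also have "\<dots> = exp (d\<^sup>2) * exp (- (2 * a * sqrt (real n)))" by (simp add: mult_exp_exp)
    finally have ex: "exp (- (d\<^sup>2 * real M)) \<le> exp (d\<^sup>2) * exp (- (2 * a * sqrt (real n)))" .
    have "real (card ?A) \<le> 2 * real (n + 1) ^ 3 * 2 ^ n * exp (- (d\<^sup>2 * real M))"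
      using d by (intro card_meets_unbalanced_le) auto
    also have "\<dots> \<le> 2 * ((6 / a) ^ 6 * exp a * exp (a * sqrt (real n))) * 2 ^ n
        * (exp (d\<^sup>2) * exp (- (2 * a * sqrt (real n))))"
      by (intro mult_mono ex cube_le_exp_sqrt[OF a]) (use a in auto)
    also have "\<dots> = C * (exp (a * sqrt (real n)) * exp (- (2 * a * sqrt (real n)))) * 2 ^ n"
      by (simp only: C_def mult_ac)
    also have "exp (a * sqrt (real n)) * exp (- (2 * a * sqrt (real n))) = exp (- a * sqrt (real n))"
      by (simp add: mult_exp_exp)
    finally have "2 ^ n - C * exp (- a * sqrt (real n)) * 2 ^ n \<le> real (card ?G)" using le by linarith
    then show ?thesis by (simp add: field_simps)
  qed
  moreover have "C > 0" using a by (simp add: C_def)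
  ultimately show ?thesis using a by blast
qed

end
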